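(* Let $\mathcal D_p=\{(X,Y)\in\mathbb S^2: I-X^2-Y^4\succeq0\}$ and $$\mathcal C=\{(X,Y)\in\mathbb S^2:\ \exists\, W\in\mathbb S\ \text{ with } I-X^2-W^2\succeq0,\ W\succeq Y^2\}.$$ Then $\operatorname{co}^{\mathrm{mat}}(\mathcal D_p)\subsetneq\mathcal C$.
   Context: $\mathbb S_n^g$ is the set of $g$-tuples of complex self-adjoint $n\times n$ matrices and $\mathbb S^g=(\mathbb S_n^g)_n$; in the definitions of $\mathcal D_p$ and $\mathcal C$ all matrices have the same (arbitrary) size $n$, so these are sequences $(\mathcal D_p(n))_n$, $(\mathcal C(n))_n$. A set $K=(K(n))_n$ with $K(n)\subseteq\mathbb S_n^g$ is matrix convex if it is closed under (coordinatewise) direct sums and $V^*XV\in K(m)$ whenever $m\le n$, $X\in K(n)$ and $V:\mathbb C^m\to\mathbb C^n$ is an isometry. $\operatorname{co}^{\mathrm{mat}}(\Gamma)$ is the smallest matrix convex set containing $\Gamma$. *)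

theory Defs
  imports "Jordan_Normal_Form.Schur_Decomposition"
begin

definition sa_mats :: "nat \<Rightarrow> complex mat set" where
  "sa_mats n = {A \<in> carrier_mat n n. mat_adjoint A = A}"

(* A g-tuple is a list of length g.  Matrix sizes are positive: level 0 is kept empty, so a
   sequence indexed by all n carries no information at n = 0. *)
definition sa_tuples :: "nat \<Rightarrow> nat \<Rightarrow> complex mat list set" where
  "sa_tuples g n = {Xs. 0 < n \<and> length Xs = g \<and> set Xs \<subseteq> sa_mats n}"

(* The inequality is that of HOL-Library.Complex_Order: 0 \<le> z means that z is real and
   nonnegative. *)
definition psd :: "nat \<Rightarrow> complex mat \<Rightarrow> bool" where
  "psd n A \<longleftrightarrow> A \<in> sa_mats n \<and> (\<forall>v \<in> carrier_vec n. 0 \<le> (A *\<^sub>v v) \<bullet>c v)"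

definition direct_sum :: "complex mat \<Rightarrow> complex mat \<Rightarrow> complex mat" where
  "direct_sum A B =
     four_block_mat A (0\<^sub>m (dim_row A) (dim_col B)) (0\<^sub>m (dim_row B) (dim_col A)) B"

definition isometries :: "nat \<Rightarrow> nat \<Rightarrow> complex mat set" where
  "isometries m n = {V \<in> carrier_mat n m. mat_adjoint V * V = 1\<^sub>m m}"

definition matrix_convex :: "nat \<Rightarrow> (nat \<Rightarrow> complex mat list set) \<Rightarrow> bool" where
  "matrix_convex g K \<longleftrightarrow>
     (\<forall>n. K n \<subseteq> sa_tuples g n) \<and>
     (\<forall>m n. \<forall>Xs \<in> K m. \<forall>Ys \<in> K n. map2 direct_sum Xs Ys \<in> K (m + n)) \<and>
     (\<forall>m n. \<forall>Xs \<in> K n. \<forall>V \<in> isometries m n.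
        1 \<le> m \<longrightarrow> m \<le> n \<longrightarrow> map (\<lambda>X. mat_adjoint V * X * V) Xs \<in> K m)"

definition co_mat :: "nat \<Rightarrow> (nat \<Rightarrow> complex mat list set) \<Rightarrow> nat \<Rightarrow> complex mat list set" where
  "co_mat g \<Gamma> n = \<Inter> {K n | K. matrix_convex g K \<and> (\<forall>k. \<Gamma> k \<subseteq> K k)}"

definition D_p :: "nat \<Rightarrow> complex mat list set" where
  "D_p n = {[X, Y] | X Y. [X, Y] \<in> sa_tuples 2 n \<and>
     psd n (1\<^sub>m n - X ^\<^sub>m 2 - Y ^\<^sub>m 4)}"

definition C_set :: "nat \<Rightarrow> complex mat list set" where
  "C_set n = {[X, Y] | X Y. [X, Y] \<in> sa_tuples 2 n \<and>
     (\<exists>W \<in> sa_mats n. psd n (1\<^sub>m n - X ^\<^sub>m 2 - W ^\<^sub>m 2) \<and> psd n (W - Y ^\<^sub>m 2))}"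

lemma mat_adjoint_dim [simp]:
  "dim_row (mat_adjoint A) = dim_col A" "dim_col (mat_adjoint A) = dim_row A"
  by (auto simp: mat_adjoint_def)

lemma mat_adjoint_index [simp]:
  "i < dim_col A \<Longrightarrow> j < dim_row A \<Longrightarrow> mat_adjoint A $$ (i, j) = conjugate (A $$ (j, i))"
  by (simp add: mat_adjoint_def mat_of_rows_index)

lemma mat_adjoint_mult:
  fixes A B :: "complex mat"
  assumes "A \<in> carrier_mat n m" "B \<in> carrier_mat m k"
  shows "mat_adjoint (A * B) = mat_adjoint B * mat_adjoint A"
  using assms
  by (intro eq_matI) (auto simp: scalar_prod_def mult.commute intro!: sum.cong)

lemma mat_adjoint_adjoint [simp]: "mat_adjoint (mat_adjoint A) = (A :: complex mat)"
  by (intro eq_matI) auto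

lemma sa_mats_direct_sum:
  assumes "A \<in> sa_mats m" "B \<in> sa_mats n"
  shows "direct_sum A B \<in> sa_mats (m + n)"
proof -
  have d: "A \<in> carrier_mat m m" "B \<in> carrier_mat n n" "mat_adjoint A = A" "mat_adjoint B = B"
    using assms by (auto simp: sa_mats_def)
  have a: "cnj (A $$ (j, i)) = A $$ (i, j)" if "i < m" "j < m" for i j
    using mat_adjoint_index[of i A j] d that by auto
  have b: "cnj (B $$ (j, i)) = B $$ (i, j)" if "i < n" "j < n" for i j
    using mat_adjoint_index[of i B j] d that by auto
  have "mat_adjoint (direct_sum A B) = direct_sum A B"
    using d(1,2) by (intro eq_matI) (auto simp: direct_sum_def a b)
  then show ?thesis using d by (auto simp: sa_mats_def direct_sum_def)
qed

lemma sa_mats_compress: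
  assumes "A \<in> sa_mats n" "V \<in> carrier_mat n m"
  shows "mat_adjoint V * A * V \<in> sa_mats m"
proof -
  have d: "A \<in> carrier_mat n n" "mat_adjoint A = A" "mat_adjoint V \<in> carrier_mat m n"
    using assms by (auto simp: sa_mats_def)
  have "mat_adjoint (mat_adjoint V * A * V) = mat_adjoint V * (A * V)"
    using d assms(2) mat_adjoint_mult[of "mat_adjoint V * A" m n V m]
      mat_adjoint_mult[of "mat_adjoint V" m n A n] by auto
  then show ?thesis using d assms(2) by (auto simp: sa_mats_def)
qed

lemma matrix_convex_sa_tuples: "matrix_convex g (sa_tuples g)"
  unfolding matrix_convex_def isometries_def sa_tuples_def
  by (auto simp: set_zip subset_iff intro!: sa_mats_direct_sum sa_mats_compress)

(* The intersection defining co_mat really is the smallest matrix convex set containing the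
   given one. *)
lemma matrix_convex_co_mat:
  assumes "\<And>n. \<Gamma> n \<subseteq> sa_tuples g n"
  shows "matrix_convex g (co_mat g \<Gamma>)"
proof -
  have mem: "Xs \<in> co_mat g \<Gamma> n \<longleftrightarrow>
      (\<forall>K. matrix_convex g K \<longrightarrow> (\<forall>k. \<Gamma> k \<subseteq> K k) \<longrightarrow> Xs \<in> K n)" for Xs n
    by (auto simp: co_mat_def)
  have "co_mat g \<Gamma> n \<subseteq> sa_tuples g n" for n
    using assms matrix_convex_sa_tuples[of g] by (auto simp: mem)
  moreover have "map2 direct_sum Xs Ys \<in> co_mat g \<Gamma> (m + n)"
    if "Xs \<in> co_mat g \<Gamma> m" "Ys \<in> co_mat g \<Gamma> n" for Xs Ys m n
    using that unfolding mem matrix_convex_def by blast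
  moreover have "map (\<lambda>X. mat_adjoint V * X * V) Xs \<in> co_mat g \<Gamma> m"
    if "Xs \<in> co_mat g \<Gamma> n" "V \<in> isometries m n" "1 \<le> m" "m \<le> n" for Xs V m n
    using that unfolding mem matrix_convex_def by blast
  ultimately show ?thesis unfolding matrix_convex_def by blast
qed

lemma co_mat_upper: "\<Gamma> n \<subseteq> co_mat g \<Gamma> n"
  by (auto simp: co_mat_def)

lemma co_mat_least:
  "matrix_convex g K \<Longrightarrow> (\<And>k. \<Gamma> k \<subseteq> K k) \<Longrightarrow> co_mat g \<Gamma> n \<subseteq> K n"
  by (auto simp: co_mat_def)

end

theory Submission
  imports Defs
begin

text \<open>The compressions \<open>(V\<^sup>*X'V, V\<^sup>*Y'V)\<close> of elements of \<open>D_p\<close> form a matrix convex set containing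
  \<open>D_p\<close>, and \<open>W = V\<^sup>*Y'\<^sup>2V\<close> witnesses that they lie in \<open>C_set\<close>, because
  \<open>V\<^sup>*A\<^sup>2V - (V\<^sup>*AV)\<^sup>2 = R\<^sup>*R\<close> with \<open>R = AV - V(V\<^sup>*AV)\<close> for self-adjoint \<open>A\<close>. If
  \<open>I - X\<^sup>2 - W\<^sup>2 = 0\<close> for this \<open>W\<close>, then \<open>R = 0\<close> for \<open>A = Y'\<^sup>2\<close>, that is \<open>Y'\<^sup>2V = VW\<close>; hence
  \<open>YW = V\<^sup>*Y'\<^sup>3V\<close> is self-adjoint and \<open>Y\<close> commutes with \<open>W\<close>. It remains to find 2 by 2 matrices with
  \<open>X\<^sup>2 + W\<^sup>2 = I\<close> and \<open>W - Y\<^sup>2\<close> positive semidefinite of rank one, such that \<open>Y\<close> and \<open>W\<close> do not commute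
  and \<open>W\<close> is the only possible witness for \<open>(X, Y)\<close>.\<close>

section \<open>Adjoints and self-adjoint matrices\<close>

lemma sa_matsD:
  "A \<in> sa_mats n \<Longrightarrow> A \<in> carrier_mat n n" "A \<in> sa_mats n \<Longrightarrow> mat_adjoint A = A"
  by (auto simp: sa_mats_def)

lemma isometriesD:
  "V \<in> isometries m n \<Longrightarrow> V \<in> carrier_mat n m"
  "V \<in> isometries m n \<Longrightarrow> mat_adjoint V * V = 1\<^sub>m m"
  by (auto simp: isometries_def)

lemma mat_adjoint_carrier:
  "A \<in> carrier_mat n m \<Longrightarrow> mat_adjoint A \<in> carrier_mat m n"
  by auto

lemma mat_adjoint_minus:
  fixes A B :: "complex mat"
  assumes "A \<in> carrier_mat n m" "B \<in> carrier_mat n m"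
  shows "mat_adjoint (A - B) = mat_adjoint A - mat_adjoint B"
  using assms by (intro eq_matI) auto

lemma mat_adjoint_add:
  fixes A B :: "complex mat"
  assumes "A \<in> carrier_mat n m" "B \<in> carrier_mat n m"
  shows "mat_adjoint (A + B) = mat_adjoint A + mat_adjoint B"
  using assms by (intro eq_matI) auto

lemma mat_adjoint_one [simp]: "mat_adjoint (1\<^sub>m n :: complex mat) = 1\<^sub>m n"
  by (intro eq_matI) auto

lemma mat_adjoint_inner:
  fixes A :: "complex mat"
  assumes "A \<in> carrier_mat n m" "x \<in> carrier_vec n" "y \<in> carrier_vec m"
  shows "(mat_adjoint A *\<^sub>v x) \<bullet>c y = x \<bullet>c (A *\<^sub>v y)"
proof -
  have "(mat_adjoint A *\<^sub>v x) \<bullet>c y = (\<Sum>j<m. \<Sum>i<n. cnj (A $$ (i, j)) * x $ i * cnj (y $ j))"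
    using assms by (auto simp: scalar_prod_def sum_distrib_right lessThan_atLeast0 intro!: sum.cong)
  also have "\<dots> = (\<Sum>i<n. \<Sum>j<m. cnj (A $$ (i, j)) * x $ i * cnj (y $ j))"
    by (rule sum.swap)
  also have "\<dots> = x \<bullet>c (A *\<^sub>v y)"
    using assms by (auto simp: scalar_prod_def sum_distrib_left lessThan_atLeast0 intro!: sum.cong)
  finally show ?thesis .
qed

lemma sa_mats_pow:
  assumes "A \<in> sa_mats n"
  shows "A ^\<^sub>m k \<in> sa_mats n"
proof -
  have c: "A \<in> carrier_mat n n" using assms by (rule sa_matsD)
  have p: "A ^\<^sub>m k \<in> carrier_mat n n" for k using c by (rule pow_carrier_mat)
  \<comment> \<open>Powers append the new factor on the right, while taking the adjoint of a product
    moves it to the left.\<close>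
  have comm: "A * A ^\<^sub>m k = A ^\<^sub>m k * A" for k
  proof (induction k)
    case 0 show ?case using c by simp
  next
    case (Suc k)
    have "A * A ^\<^sub>m Suc k = (A * A ^\<^sub>m k) * A"
      using c p[of k] by (simp add: assoc_mult_mat[of _ n n _ n _ n])
    then show ?case using Suc by simp
  qed
  have "mat_adjoint (A ^\<^sub>m k) = A ^\<^sub>m k"
  proof (induction k)
    case 0 show ?case by simp
  next
    case (Suc k)
    show ?case using Suc mat_adjoint_mult[OF p[of k] c] sa_matsD(2)[OF assms] comm by simp
  qed
  then show ?thesis using p by (simp add: sa_mats_def)
qed

lemma sa_mats_add: "A \<in> sa_mats n \<Longrightarrow> B \<in> sa_mats n \<Longrightarrow> A + B \<in> sa_mats n"
  by (auto simp: sa_mats_def mat_adjoint_add[of _ n n])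

section \<open>Positive semidefinite matrices and Gram matrices\<close>

lemma psd_add:
  assumes "psd n A" "psd n B"
  shows "psd n (A + B)"
proof -
  have c: "A \<in> carrier_mat n n" "B \<in> carrier_mat n n"
    using assms by (auto simp: psd_def dest: sa_matsD)
  have "((A + B) *\<^sub>v v) \<bullet>c v = (A *\<^sub>v v) \<bullet>c v + (B *\<^sub>v v) \<bullet>c v" if "v \<in> carrier_vec n" for v
    using c that
    by (simp add: add_mult_distrib_mat_vec[of _ n n] add_scalar_prod_distrib[of _ n])
  then show ?thesis using assms by (auto simp: psd_def sa_mats_add)
qed

lemma compress_inner:
  fixes A :: "complex mat"
  assumes "A \<in> carrier_mat N N" "V \<in> carrier_mat N n" "v \<in> carrier_vec n"
  shows "((mat_adjoint V * A * V) *\<^sub>v v) \<bullet>c v = (A *\<^sub>v (V *\<^sub>v v)) \<bullet>c (V *\<^sub>v v)"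
proof -
  have "(mat_adjoint V * A * V) *\<^sub>v v = mat_adjoint V *\<^sub>v (A *\<^sub>v (V *\<^sub>v v))"
    using assms mat_adjoint_carrier[OF assms(2)]
    by (simp add: assoc_mult_mat_vec[of _ n N _ N] assoc_mult_mat_vec[of _ n N _ n])
  then show ?thesis using assms by (simp add: mat_adjoint_inner[of _ N n])
qed

lemma psd_compress:
  assumes "psd N A" "V \<in> carrier_mat N n"
  shows "psd n (mat_adjoint V * A * V)"
proof -
  have A: "A \<in> sa_mats N" "A \<in> carrier_mat N N" using assms by (auto simp: psd_def dest: sa_matsD)
  have "0 \<le> ((mat_adjoint V * A * V) *\<^sub>v v) \<bullet>c v" if "v \<in> carrier_vec n" for v
    using compress_inner[OF A(2) assms(2) that] assms that by (simp add: psd_def)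
  then show ?thesis using sa_mats_compress[OF A(1) assms(2)] by (simp add: psd_def)
qed

lemma gram_inner:
  fixes R :: "complex mat"
  assumes "R \<in> carrier_mat N n" "v \<in> carrier_vec n"
  shows "((mat_adjoint R * R) *\<^sub>v v) \<bullet>c v = (R *\<^sub>v v) \<bullet>c (R *\<^sub>v v)"
  using assms mat_adjoint_carrier[OF assms(1)]
  by (simp add: assoc_mult_mat_vec[of _ n N _ n] mat_adjoint_inner[of _ N n])

lemma psd_gram:
  assumes "R \<in> carrier_mat N n"
  shows "psd n (mat_adjoint R * R)"
proof -
  have "mat_adjoint R * R \<in> sa_mats n"
    using mult_carrier_mat[OF mat_adjoint_carrier[OF assms] assms]
      mat_adjoint_mult[OF mat_adjoint_carrier[OF assms] assms] by (simp add: sa_mats_def)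
  moreover have "0 \<le> ((mat_adjoint R * R) *\<^sub>v v) \<bullet>c v" if "v \<in> carrier_vec n" for v
    unfolding gram_inner[OF assms that] by (rule conjugate_square_ge_0_vec)
  ultimately show ?thesis by (simp add: psd_def)
qed

text \<open>Two nonnegative numbers with sum zero both vanish. The conclusion stays at the level of
  the quadratic form because \<open>gram_inner_eq_0\<close> takes it from there.\<close>

lemma psd_sum_eq_0:
  assumes "psd n A" "psd n B" "A + B = 0\<^sub>m n n"
  shows "\<forall>v \<in> carrier_vec n. (A *\<^sub>v v) \<bullet>c v = 0"
proof
  fix v :: "complex vec" assume v: "v \<in> carrier_vec n"
  have c: "A \<in> carrier_mat n n" "B \<in> carrier_mat n n"
    using assms by (auto simp: psd_def dest: sa_matsD)
  have "(A *\<^sub>v v) \<bullet>c v + (B *\<^sub>v v) \<bullet>c v = ((A + B) *\<^sub>v v) \<bullet>c v"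
    using c v
    by (simp add: add_mult_distrib_mat_vec[of _ n n] add_scalar_prod_distrib[of _ n])
  also have "\<dots> = 0\<^sub>v n \<bullet>c v"
    using v assms(3) by (intro arg_cong[of _ _ "\<lambda>x. x \<bullet>c v"]) (auto simp: scalar_prod_def)
  also have "\<dots> = 0" using v by simp
  finally have "(A *\<^sub>v v) \<bullet>c v + (B *\<^sub>v v) \<bullet>c v = 0" .
  moreover have "0 \<le> (A *\<^sub>v v) \<bullet>c v" "0 \<le> (B *\<^sub>v v) \<bullet>c v"
    using assms v by (auto simp: psd_def)
  ultimately show "(A *\<^sub>v v) \<bullet>c v = 0" by (simp add: add_nonneg_eq_0_iff)
qed

text \<open>The form of the Gram matrix at \<open>v\<close> is the squared norm of
  \<open>R *\<^sub>v v\<close>; at unit vectors this kills \<open>R\<close> column by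
  column.\<close>

lemma gram_inner_eq_0:
  fixes R :: "complex mat"
  assumes "R \<in> carrier_mat N n"
    and "\<forall>v \<in> carrier_vec n. ((mat_adjoint R * R) *\<^sub>v v) \<bullet>c v = 0"
  shows "R = 0\<^sub>m N n"
proof (rule eq_matI)
  fix i j assume ij: "i < dim_row (0\<^sub>m N n :: complex mat)" "j < dim_col (0\<^sub>m N n :: complex mat)"
  have c: "R *\<^sub>v unit_vec n j \<in> carrier_vec N" using assms(1) by auto
  have 0: "R *\<^sub>v unit_vec n j = 0\<^sub>v N"
    using assms gram_inner[OF assms(1), of "unit_vec n j"] conjugate_square_eq_0_vec[OF c] by simp
  have "R $$ (i, j) = (R *\<^sub>v unit_vec n j) $ i"
    using assms(1) ij by (simp add: scalar_prod_right_unit[of _ n])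
  then show "R $$ (i, j) = 0\<^sub>m N n $$ (i, j)" using 0 ij by simp
qed (use assms in auto)

section \<open>Compression of a square\<close>

lemma compress_minus:
  fixes A B :: "complex mat"
  assumes "A \<in> carrier_mat N N" "B \<in> carrier_mat N N" "V \<in> carrier_mat N n"
  shows "mat_adjoint V * (A - B) * V = mat_adjoint V * A * V - mat_adjoint V * B * V"
  using assms mat_adjoint_carrier[OF assms(3)]
  by (simp add: mult_minus_distrib_mat[of _ n N _ N] minus_mult_distrib_mat[of _ n N _ _ n])

text \<open>\<open>R\<close> is the part of \<open>A * V\<close> orthogonal to the range of
  \<open>V\<close>: since \<open>V\<close> is an isometry, \<open>mat_adjoint V * R\<close>
  vanishes. So the term \<open>V * B\<close> in the left factor contributes nothing, and only
  \<open>mat_adjoint V * A * R\<close> has to be expanded.\<close>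

lemma compress_square:
  assumes A: "A \<in> sa_mats N" and V: "V \<in> isometries n N"
  defines "B \<equiv> mat_adjoint V * A * V"
  defines "R \<equiv> A * V - V * B"
  shows "mat_adjoint R * R = mat_adjoint V * (A * A) * V - B * B"
proof -
  have c: "A \<in> carrier_mat N N" "V \<in> carrier_mat N n" "mat_adjoint V \<in> carrier_mat n N"
    using A V by (auto simp: sa_mats_def isometries_def mat_adjoint_carrier)
  have B: "B \<in> sa_mats n" "B \<in> carrier_mat n n"
    using sa_mats_compress[OF A c(2)] by (auto simp: B_def dest: sa_matsD)
  have Rc: "A * V \<in> carrier_mat N n" "V * B \<in> carrier_mat N n" "R \<in> carrier_mat N n"
    unfolding R_def
    by (rule mult_carrier_mat[OF c(1,2)] mult_carrier_mat[OF c(2) B(2)] minus_carrier_mat)+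
  have adj: "mat_adjoint R = mat_adjoint V * A - B * mat_adjoint V"
    using mat_adjoint_minus[OF Rc(1,2)] mat_adjoint_mult[OF c(1,2)] mat_adjoint_mult[OF c(2) B(2)]
      sa_matsD(2)[OF A] sa_matsD(2)[OF B(1)] by (simp add: R_def)
  have VR: "mat_adjoint V * R = 0\<^sub>m n n"
  proof -
    have "mat_adjoint V * R = mat_adjoint V * (A * V) - mat_adjoint V * (V * B)"
      unfolding R_def by (rule mult_minus_distrib_mat[OF c(3) Rc(1,2)])
    also have "mat_adjoint V * (A * V) = B"
      unfolding B_def by (rule assoc_mult_mat[OF c(3,1,2), symmetric])
    also have "mat_adjoint V * (V * B) = (mat_adjoint V * V) * B"
      by (rule assoc_mult_mat[OF c(3,2) B(2), symmetric])
    also have "\<dots> = B" using isometriesD(2)[OF V] B(2) by simp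
    finally show ?thesis using B(2) by simp
  qed
  have "mat_adjoint R * R = mat_adjoint V * A * R - B * mat_adjoint V * R"
    unfolding adj using c B Rc by (intro minus_mult_distrib_mat[of _ n N _ _ n]) auto
  also have "B * mat_adjoint V * R = B * (mat_adjoint V * R)"
    by (rule assoc_mult_mat[OF B(2) c(3) Rc(3)])
  also have "\<dots> = 0\<^sub>m n n" using VR B(2) by simp
  also have "mat_adjoint V * A * R - 0\<^sub>m n n = mat_adjoint V * A * R"
    using c Rc by (intro eq_matI) auto
  also have "\<dots> = mat_adjoint V * A * (A * V) - mat_adjoint V * A * (V * B)"
    unfolding R_def using c Rc(1,2) by (intro mult_minus_distrib_mat[of _ n N _ n]) auto
  also have "mat_adjoint V * A * (A * V) = mat_adjoint V * (A * A) * V"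
    using c by (simp add: assoc_mult_mat[of _ n N _ N _ N] assoc_mult_mat[of _ n N _ N _ n]
        assoc_mult_mat[of _ N N _ N _ n])
  also have "mat_adjoint V * A * (V * B) = B * B"
    using assoc_mult_mat[OF mult_carrier_mat[OF c(3,1)] c(2) B(2)] by (simp add: B_def)
  finally show ?thesis .
qed

section \<open>Direct sums, and composition of compressions\<close>

lemma direct_sum_carrier:
  "A \<in> carrier_mat n m \<Longrightarrow> B \<in> carrier_mat n' m' \<Longrightarrow> direct_sum A B \<in> carrier_mat (n + n') (m + m')"
  by (auto simp: direct_sum_def)

lemma direct_sum_mult:
  fixes A B A' B' :: "complex mat"
  assumes "A \<in> carrier_mat n m" "A' \<in> carrier_mat m k"
    and "B \<in> carrier_mat n' m'" "B' \<in> carrier_mat m' k'"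
  shows "direct_sum A B * direct_sum A' B' = direct_sum (A * A') (B * B')"
proof -
  have "direct_sum A B * direct_sum A' B' =
     four_block_mat (A * A' + 0\<^sub>m n m' * 0\<^sub>m m' k) (A * 0\<^sub>m m k' + 0\<^sub>m n m' * B')
       (0\<^sub>m n' m * A' + B * 0\<^sub>m m' k) (0\<^sub>m n' m * 0\<^sub>m m k' + B * B')"
    using assms unfolding direct_sum_def
    by (subst mult_four_block_mat[of _ n m _ m' _ n' _ _ k _ k']) auto
  then show ?thesis using assms by (simp add: direct_sum_def)
qed

lemma direct_sum_adjoint:
  fixes A B :: "complex mat"
  shows "mat_adjoint (direct_sum A B) = direct_sum (mat_adjoint A) (mat_adjoint B)"
  by (intro eq_matI) (auto simp: direct_sum_def)

lemma direct_sum_minus: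
  fixes A B A' B' :: "complex mat"
  assumes "A \<in> carrier_mat n m" "A' \<in> carrier_mat n m"
    and "B \<in> carrier_mat n' m'" "B' \<in> carrier_mat n' m'"
  shows "direct_sum A B - direct_sum A' B' = direct_sum (A - A') (B - B')"
  using assms by (intro eq_matI) (auto simp: direct_sum_def)

lemma direct_sum_one: "direct_sum (1\<^sub>m m) (1\<^sub>m n) = (1\<^sub>m (m + n) :: complex mat)"
  by (simp add: direct_sum_def)

lemma direct_sum_pow:
  fixes A B :: "complex mat"
  assumes "A \<in> carrier_mat m m" "B \<in> carrier_mat n n"
  shows "direct_sum A B ^\<^sub>m k = direct_sum (A ^\<^sub>m k) (B ^\<^sub>m k)"
proof (induction k)
  case 0
  show ?case using assms by (simp add: direct_sum_def)
next
  case (Suc k)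
  then show ?case
    using direct_sum_mult[of "A ^\<^sub>m k" m m A m "B ^\<^sub>m k" n n B n] assms by (simp add: pow_carrier_mat)
qed

lemma psd_direct_sum:
  assumes "psd m A" "psd n B"
  shows "psd (m + n) (direct_sum A B)"
proof -
  have sa: "A \<in> sa_mats m" "B \<in> sa_mats n" using assms by (auto simp: psd_def)
  have c: "A \<in> carrier_mat m m" "B \<in> carrier_mat n n" using sa by (auto dest: sa_matsD)
  have "0 \<le> (direct_sum A B *\<^sub>v v) \<bullet>c v" if v: "v \<in> carrier_vec (m + n)" for v
  proof -
    define x y where "x = vec_first v m" and "y = vec_last v n"
    have xy: "x \<in> carrier_vec m" "y \<in> carrier_vec n" by (simp_all add: x_def y_def)
    have v': "v = x @\<^sub>v y" using v by (simp add: x_def y_def)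
    have cj: "conjugate v = conjugate x @\<^sub>v conjugate y"
      using xy by (intro eq_vecI) (auto simp: v')
    have "direct_sum A B *\<^sub>v v = (A *\<^sub>v x) @\<^sub>v (B *\<^sub>v y)"
      using c xy by (simp add: direct_sum_def v' mult_mat_vec_split)
    then have "(direct_sum A B *\<^sub>v v) \<bullet>c v = (A *\<^sub>v x) \<bullet>c x + (B *\<^sub>v y) \<bullet>c y"
      unfolding cj using c xy by (simp add: scalar_prod_append[of _ m _ n])
    then show ?thesis using assms xy by (simp add: psd_def)
  qed
  then show ?thesis using sa_mats_direct_sum[OF sa] by (simp add: psd_def)
qed

lemma isometries_direct_sum:
  assumes "V \<in> isometries m M" "V' \<in> isometries n N"
  shows "direct_sum V V' \<in> isometries (m + n) (M + N)"
proof -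
  note c = isometriesD(1)[OF assms(1)] isometriesD(1)[OF assms(2)]
  have "mat_adjoint (direct_sum V V') * direct_sum V V' =
      direct_sum (mat_adjoint V * V) (mat_adjoint V' * V')"
    unfolding direct_sum_adjoint
    by (rule direct_sum_mult[OF mat_adjoint_carrier[OF c(1)] c(1) mat_adjoint_carrier[OF c(2)] c(2)])
  then show ?thesis
    using direct_sum_carrier[OF c] isometriesD(2)[OF assms(1)] isometriesD(2)[OF assms(2)]
    by (simp add: isometries_def direct_sum_one)
qed

lemma isometries_mult:
  assumes "V \<in> isometries n N" "U \<in> isometries m n"
  shows "V * U \<in> isometries m N"
proof -
  have c: "V \<in> carrier_mat N n" "U \<in> carrier_mat n m"
    "mat_adjoint V \<in> carrier_mat n N" "mat_adjoint U \<in> carrier_mat m n"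
    using assms by (auto simp: isometries_def mat_adjoint_carrier)
  have "mat_adjoint (V * U) * (V * U) = mat_adjoint U * (mat_adjoint V * V) * U"
    using c by (simp add: mat_adjoint_mult[OF c(1,2)] assoc_mult_mat[of _ m n _ N _ m]
        assoc_mult_mat[of _ m n _ n _ m] assoc_mult_mat[of _ n N _ n _ m])
  then show ?thesis using assms c by (simp add: isometries_def)
qed

lemma compress_compress:
  fixes A :: "complex mat"
  assumes "A \<in> carrier_mat N N" "V \<in> carrier_mat N n" "U \<in> carrier_mat n m"
  shows "mat_adjoint U * (mat_adjoint V * A * V) * U = mat_adjoint (V * U) * A * (V * U)"
proof -
  note c = assms mat_adjoint_carrier[OF assms(2)] mat_adjoint_carrier[OF assms(3)]
  note AV = mult_carrier_mat[OF c(1,2)] and VU = mult_carrier_mat[OF c(2,3)]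
  have "mat_adjoint U * (mat_adjoint V * A * V) * U = mat_adjoint U * (mat_adjoint V * (A * (V * U)))"
    unfolding assoc_mult_mat[OF c(4,1,2)] assoc_mult_mat[OF c(5) mult_carrier_mat[OF c(4) AV] c(3)]
      assoc_mult_mat[OF c(4) AV c(3)] assoc_mult_mat[OF c(1-3)] ..
  also have "\<dots> = mat_adjoint (V * U) * A * (V * U)"
    unfolding mat_adjoint_mult[OF c(2,3)]
      assoc_mult_mat[OF mult_carrier_mat[OF c(5,4)] c(1) VU]
      assoc_mult_mat[OF c(5,4) mult_carrier_mat[OF c(1) VU]] ..
  finally show ?thesis .
qed

lemma compress_direct_sum:
  fixes A B :: "complex mat"
  assumes "A \<in> carrier_mat M M" "V \<in> carrier_mat M m" "B \<in> carrier_mat N N" "U \<in> carrier_mat N n"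
  shows "direct_sum (mat_adjoint V * A * V) (mat_adjoint U * B * U) =
    mat_adjoint (direct_sum V U) * direct_sum A B * direct_sum V U"
proof -
  note c = assms mat_adjoint_carrier[OF assms(2)] mat_adjoint_carrier[OF assms(4)]
  show ?thesis
    unfolding direct_sum_adjoint direct_sum_mult[OF c(5,1,6,3)]
      direct_sum_mult[OF mult_carrier_mat[OF c(5,1)] c(2) mult_carrier_mat[OF c(6,3)] c(4)] ..
qed

section \<open>A matrix convex set containing \<open>D_p\<close>\<close>

text \<open>\<open>D_p\<close> is closed under direct sums, so one compression of one element is
  enough; no sums of several compressions occur. The size \<open>N\<close> is arbitrary, and
  \<open>0 < n\<close> keeps level 0 empty, as \<open>sa_tuples\<close> demands.\<close>

definition D_p_compressions :: "nat \<Rightarrow> complex mat list set" where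
  "D_p_compressions n = {[mat_adjoint V * X * V, mat_adjoint V * Y * V] | N V X Y.
     [X, Y] \<in> D_p N \<and> V \<in> isometries n N \<and> 0 < n}"

lemma D_pD:
  assumes "[X, Y] \<in> D_p n"
  shows "0 < n" "X \<in> sa_mats n" "Y \<in> sa_mats n" "psd n (1\<^sub>m n - X ^\<^sub>m 2 - Y ^\<^sub>m 4)"
  using assms by (auto simp: D_p_def sa_tuples_def)

lemma D_p_direct_sum:
  assumes "[X, Y] \<in> D_p m" "[X', Y'] \<in> D_p n"
  shows "[direct_sum X X', direct_sum Y Y'] \<in> D_p (m + n)"
proof -
  note D = D_pD[OF assms(1)] and D' = D_pD[OF assms(2)]
  note c = sa_matsD(1)[OF D(2)] sa_matsD(1)[OF D(3)] sa_matsD(1)[OF D'(2)] sa_matsD(1)[OF D'(3)]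
  have "1\<^sub>m (m + n) - direct_sum X X' ^\<^sub>m 2 - direct_sum Y Y' ^\<^sub>m 4 =
     direct_sum (1\<^sub>m m - X ^\<^sub>m 2 - Y ^\<^sub>m 4) (1\<^sub>m n - X' ^\<^sub>m 2 - Y' ^\<^sub>m 4)"
    using c by (simp add: direct_sum_pow direct_sum_one[symmetric] pow_carrier_mat minus_carrier_mat
        direct_sum_minus[of _ m m _ _ n n])
  then have "psd (m + n) (1\<^sub>m (m + n) - direct_sum X X' ^\<^sub>m 2 - direct_sum Y Y' ^\<^sub>m 4)"
    using psd_direct_sum[OF D(4) D'(4)] by simp
  then show ?thesis
    using D D' by (simp add: D_p_def sa_tuples_def sa_mats_direct_sum)
qed

text \<open>A direct sum of compressions by \<open>V\<close> and \<open>U\<close> is the compression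
  of a direct sum by \<open>direct_sum V U\<close>, and compressing by \<open>V\<close> and then by
  \<open>U\<close> is compressing by \<open>V * U\<close>.\<close>

lemma matrix_convex_D_p_compressions: "matrix_convex 2 D_p_compressions"
  unfolding matrix_convex_def
proof (intro conjI allI ballI impI)
  fix n
  show "D_p_compressions n \<subseteq> sa_tuples 2 n"
    by (auto simp: D_p_compressions_def sa_tuples_def
        dest: D_pD isometriesD(1) intro!: sa_mats_compress)
next
  fix m n Xs Ys assume "Xs \<in> D_p_compressions m" "Ys \<in> D_p_compressions n"
  then obtain M V X Y N U X' Y' where
    Xs: "Xs = [mat_adjoint V * X * V, mat_adjoint V * Y * V]"
      "[X, Y] \<in> D_p M" "V \<in> isometries m M" "0 < m" and
    Ys: "Ys = [mat_adjoint U * X' * U, mat_adjoint U * Y' * U]"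
      "[X', Y'] \<in> D_p N" "U \<in> isometries n N" "0 < n"
    by (auto simp: D_p_compressions_def)
  note c = D_pD(2,3)[OF Xs(2), THEN sa_matsD(1)] D_pD(2,3)[OF Ys(2), THEN sa_matsD(1)]
    isometriesD(1)[OF Xs(3)] isometriesD(1)[OF Ys(3)]
  show "map2 direct_sum Xs Ys \<in> D_p_compressions (m + n)"
    unfolding D_p_compressions_def mem_Collect_eq
    using D_p_direct_sum[OF Xs(2) Ys(2)] isometries_direct_sum[OF Xs(3) Ys(3)] Xs(4)
    by (intro exI[of _ "M + N"] exI[of _ "direct_sum V U"] exI[of _ "direct_sum X X'"]
        exI[of _ "direct_sum Y Y'"]) (simp add: Xs(1) Ys(1) compress_direct_sum[OF c(1,5,3,6)]
        compress_direct_sum[OF c(2,5,4,6)])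
next
  fix m n :: nat and Xs U
  assume "Xs \<in> D_p_compressions n" and U: "U \<in> isometries m n" and m: "1 \<le> m"
  then obtain N V X Y where
    Xs: "Xs = [mat_adjoint V * X * V, mat_adjoint V * Y * V]"
      "[X, Y] \<in> D_p N" "V \<in> isometries n N"
    by (auto simp: D_p_compressions_def)
  note c = D_pD(2,3)[OF Xs(2), THEN sa_matsD(1)] isometriesD(1)[OF Xs(3)] isometriesD(1)[OF U]
  show "map (\<lambda>X. mat_adjoint U * X * U) Xs \<in> D_p_compressions m"
    unfolding D_p_compressions_def mem_Collect_eq
    using Xs(2) isometries_mult[OF Xs(3) U] m
    by (intro exI[of _ N] exI[of _ "V * U"] exI[of _ X] exI[of _ Y])
      (simp add: Xs(1) compress_compress[OF c(1,3,4)] compress_compress[OF c(2,3,4)])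
qed

lemma D_p_subset_compressions: "D_p n \<subseteq> D_p_compressions n"
proof
  fix Xs assume "Xs \<in> D_p n"
  then obtain X Y where Xs: "Xs = [X, Y]" "[X, Y] \<in> D_p n" by (auto simp: D_p_def)
  note D = D_pD[OF Xs(2)]
  have "1\<^sub>m n \<in> isometries n n" by (simp add: isometries_def)
  then show "Xs \<in> D_p_compressions n"
    unfolding D_p_compressions_def mem_Collect_eq
    using Xs D sa_matsD(1)[OF D(2)] sa_matsD(1)[OF D(3)]
    by (intro exI[of _ n] exI[of _ "1\<^sub>m n"] exI[of _ X] exI[of _ Y]) simp
qed

lemma co_mat_D_p_subset: "co_mat 2 D_p n \<subseteq> D_p_compressions n"
  by (rule co_mat_least[OF matrix_convex_D_p_compressions D_p_subset_compressions])

section \<open>Compressions lie in \<open>C_set\<close>, and the case of equality\<close>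

lemma pow_mat_2: "A \<in> carrier_mat n n \<Longrightarrow> A ^\<^sub>m 2 = A * A"
  by (simp add: numeral_2_eq_2)

lemma pow_mat_4: "A \<in> carrier_mat n n \<Longrightarrow> A ^\<^sub>m 4 = (A * A) * (A * A)"
  by (simp add: eval_nat_numeral assoc_mult_mat[of _ n n _ n _ n])

text \<open>Since \<open>c\<close> is unital, the left-hand side is \<open>c\<close> of the defect
  of \<open>(X, Y)\<close> in \<open>D_p\<close>, plus the compression gap of the square of
  \<open>X\<close>, plus that of the square of \<open>Y ^\<^sub>m 2\<close>. By
  \<open>compress_square\<close> each gap is a Gram matrix. The last one is kept visible, because it
  must vanish in the case of equality; the first two form \<open>S\<close>.\<close>

lemma compression_defect:
  assumes D: "[X, Y] \<in> D_p N" and V: "V \<in> isometries n N"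
  defines "c \<equiv> \<lambda>A. mat_adjoint V * A * V"
  defines "d \<equiv> \<lambda>A. A * V - V * c A"
  obtains S where "psd n S"
    "1\<^sub>m n - c X ^\<^sub>m 2 - c (Y ^\<^sub>m 2) ^\<^sub>m 2 = mat_adjoint (d (Y ^\<^sub>m 2)) * d (Y ^\<^sub>m 2) + S"
proof -
  note XY = D_pD[OF D]
  have car: "X \<in> carrier_mat N N" "Y \<in> carrier_mat N N" "V \<in> carrier_mat N n"
    "Y * Y \<in> carrier_mat N N" "X * X \<in> carrier_mat N N" "mat_adjoint V \<in> carrier_mat n N"
    "(Y * Y) * (Y * Y) \<in> carrier_mat N N"
    using XY V by (auto simp: sa_mats_def isometries_def mat_adjoint_carrier)
  have cc: "c A \<in> carrier_mat n n" if "A \<in> carrier_mat N N" for A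
    using that car by (auto simp: c_def)
  have dd: "d A \<in> carrier_mat N n" if "A \<in> carrier_mat N N" for A
    unfolding d_def by (rule minus_carrier_mat mult_carrier_mat[OF car(3) cc[OF that]])+
  have YY: "Y ^\<^sub>m 2 \<in> sa_mats N" "Y ^\<^sub>m 2 = Y * Y"
    using XY(3) car by (auto intro: sa_mats_pow pow_mat_2)
  have sq: "mat_adjoint (d A) * d A = c (A * A) - c A * c A" if "A \<in> sa_mats N" for A
    using compress_square[OF that V] by (simp add: c_def d_def)
  have sqY: "mat_adjoint (d (Y * Y)) * d (Y * Y) = c ((Y * Y) * (Y * Y)) - c (Y * Y) * c (Y * Y)"
    using sq[OF YY(1)] YY(2) by simp
  define P where "P = 1\<^sub>m N - X * X - (Y * Y) * (Y * Y)"
  have P: "psd N P" using XY(4) pow_mat_2[OF car(1)] pow_mat_4[OF car(2)] by (simp add: P_def)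
  have one: "c (1\<^sub>m N) = 1\<^sub>m n" using car isometriesD(2)[OF V] by (simp add: c_def)
  have cP: "c P = 1\<^sub>m n - c (X * X) - c ((Y * Y) * (Y * Y))"
    using car unfolding one[symmetric] unfolding c_def P_def
    by (simp add: compress_minus[of _ N _ _ n] minus_carrier_mat)
  define S where "S = c P + mat_adjoint (d X) * d X"
  have "psd n S" unfolding S_def
    using psd_compress[OF P car(3)] psd_gram[OF dd[OF car(1)]] by (intro psd_add) (auto simp: c_def)
  moreover have "1\<^sub>m n - c X ^\<^sub>m 2 - c (Y ^\<^sub>m 2) ^\<^sub>m 2 = mat_adjoint (d (Y ^\<^sub>m 2)) * d (Y ^\<^sub>m 2) + S"
    unfolding S_def YY(2) sq[OF XY(2)] sqY cP pow_mat_2[OF cc[OF car(1)]] pow_mat_2[OF cc[OF car(4)]]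
    using cc[OF car(1)] cc[OF car(4)] cc[OF car(5)] cc[OF car(7)]
    by (intro eq_matI) auto
  ultimately show thesis using that by blast
qed

text \<open>This is Kadison's inequality for a compression: the gap is a Gram matrix.\<close>

lemma compression_square_ge:
  assumes Y: "Y \<in> sa_mats N" and V: "V \<in> isometries n N"
  shows "psd n (mat_adjoint V * Y ^\<^sub>m 2 * V - (mat_adjoint V * Y * V) ^\<^sub>m 2)"
proof -
  have c: "Y \<in> carrier_mat N N" "V \<in> carrier_mat N n"
    "mat_adjoint V * Y * V \<in> carrier_mat n n" "Y * V - V * (mat_adjoint V * Y * V) \<in> carrier_mat N n"
    using Y V by (auto simp: sa_mats_def isometries_def mat_adjoint_carrier)
  show ?thesis
    using compress_square[OF Y V] psd_gram[OF c(4)] pow_mat_2[OF c(1)] pow_mat_2[OF c(3)] by simp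
qed

lemma compression_psd:
  assumes D: "[X, Y] \<in> D_p N" and V: "V \<in> isometries n N"
  defines "c \<equiv> \<lambda>A. mat_adjoint V * A * V"
  shows "psd n (1\<^sub>m n - c X ^\<^sub>m 2 - c (Y ^\<^sub>m 2) ^\<^sub>m 2)"
proof -
  note XY = D_pD[OF D] and V' = isometriesD(1)[OF V]
  have W: "c (Y ^\<^sub>m 2) \<in> carrier_mat n n"
    unfolding c_def by (rule sa_matsD(1)[OF sa_mats_compress[OF sa_mats_pow[OF XY(3)] V']])
  have R: "Y ^\<^sub>m 2 * V - V * c (Y ^\<^sub>m 2) \<in> carrier_mat N n"
    by (rule minus_carrier_mat mult_carrier_mat[OF V' W])+
  obtain S where "psd n S" "1\<^sub>m n - c X ^\<^sub>m 2 - c (Y ^\<^sub>m 2) ^\<^sub>m 2 =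
      mat_adjoint (Y ^\<^sub>m 2 * V - V * c (Y ^\<^sub>m 2)) * (Y ^\<^sub>m 2 * V - V * c (Y ^\<^sub>m 2)) + S"
    using compression_defect[OF D V] unfolding c_def by blast
  then show ?thesis using psd_add[OF psd_gram[OF R]] by simp
qed

lemma compressions_subset_C_set: "D_p_compressions n \<subseteq> C_set n"
proof
  fix Xs assume "Xs \<in> D_p_compressions n"
  then obtain N V X Y where
    Xs: "Xs = [mat_adjoint V * X * V, mat_adjoint V * Y * V]"
      "[X, Y] \<in> D_p N" "V \<in> isometries n N" "0 < n"
    by (auto simp: D_p_compressions_def)
  note XY = D_pD[OF Xs(2)] and V = isometriesD(1)[OF Xs(3)]
  show "Xs \<in> C_set n"
    using compression_psd[OF Xs(2,3)] compression_square_ge[OF XY(3) Xs(3)] Xs(4)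
      sa_mats_compress[OF XY(2) V] sa_mats_compress[OF XY(3) V]
      sa_mats_compress[OF sa_mats_pow[OF XY(3), of 2] V]
    by (auto simp: C_set_def sa_tuples_def Xs(1))
qed

lemma compression_commute:
  assumes D: "[X, Y] \<in> D_p N" and V: "V \<in> isometries n N"
  defines "c \<equiv> \<lambda>A. mat_adjoint V * A * V"
  assumes eq: "1\<^sub>m n - c X ^\<^sub>m 2 - c (Y ^\<^sub>m 2) ^\<^sub>m 2 = 0\<^sub>m n n"
  shows "c Y * c (Y ^\<^sub>m 2) = c (Y ^\<^sub>m 2) * c Y"
proof -
  note XY = D_pD[OF D]
  define T W R where "T = Y ^\<^sub>m 2" and "W = c T" and "R = T * V - V * W"
  have T: "T \<in> sa_mats N" using XY(3) by (simp add: T_def sa_mats_pow)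
  have car: "Y \<in> carrier_mat N N" "T \<in> carrier_mat N N" "V \<in> carrier_mat N n"
    "mat_adjoint V \<in> carrier_mat n N"
    using XY T V by (auto simp: sa_mats_def isometries_def mat_adjoint_carrier)
  have W: "W \<in> sa_mats n" "W \<in> carrier_mat n n"
    using sa_mats_compress[OF T car(3)] by (auto simp: W_def c_def dest: sa_matsD)
  have R: "R \<in> carrier_mat N n"
    unfolding R_def by (rule minus_carrier_mat mult_carrier_mat[OF car(3) W(2)])+
  obtain S where S: "psd n S" "0\<^sub>m n n = mat_adjoint R * R + S"
    using compression_defect[OF D V] eq unfolding c_def R_def W_def T_def by metis
  \<comment> \<open>The zero matrix is here a sum of two positive semidefinite matrices, one of
    which is the Gram matrix of \<open>R\<close>.\<close>
  have R0: "R = 0\<^sub>m N n"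
    by (rule gram_inner_eq_0[OF R]) (rule psd_sum_eq_0[OF psd_gram[OF R] S(1) S(2)[symmetric]])
  have TV: "T * V = V * W"
  proof (rule eq_matI)
    fix i j assume ij: "i < dim_row (V * W)" "j < dim_col (V * W)"
    have "R $$ (i, j) = 0" using R0 ij car W by simp
    then show "(T * V) $$ (i, j) = (V * W) $$ (i, j)"
      unfolding R_def using ij car W by simp
  qed (use car W in auto)
  have cY: "c Y \<in> sa_mats n" using sa_mats_compress[OF XY(3) car(3)] by (simp add: c_def)
  have "c Y * W = mat_adjoint V * Y * (V * W)"
    unfolding c_def by (rule assoc_mult_mat[OF mult_carrier_mat[OF car(4,1)] car(3) W(2)])
  also have "\<dots> = mat_adjoint V * (Y * T) * V"
    unfolding TV[symmetric]
    using car by (simp add: assoc_mult_mat[of _ n N _ N _ N] assoc_mult_mat[of _ n N _ N _ n]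
        assoc_mult_mat[of _ N N _ N _ n])
  finally have 1: "c Y * W = c (Y * T)" by (simp add: c_def)
  \<comment> \<open>As a power of \<open>Y\<close> this product is self-adjoint, hence so is its
    compression \<open>c Y * W\<close>; but the adjoint of \<open>c Y * W\<close> is
    \<open>W * c Y\<close>.\<close>
  have "Y ^\<^sub>m 3 = Y * T"
    using assoc_mult_mat[OF car(1,1,1)] car(1) by (simp add: T_def numeral_3_eq_3 numeral_2_eq_2)
  then have "Y * T \<in> sa_mats N" using sa_mats_pow[OF XY(3), of 3] by simp
  then have "c Y * W \<in> sa_mats n" using 1 car(3) by (simp add: c_def sa_mats_compress)
  then have "c Y * W = mat_adjoint (c Y * W)" by (simp add: sa_matsD)
  also have "\<dots> = W * c Y"
    using mat_adjoint_mult[OF sa_matsD(1)[OF cY] W(2)] sa_matsD(2)[OF cY] sa_matsD(2)[OF W(1)] by simp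
  finally show ?thesis by (simp add: W_def T_def)
qed

section \<open>Entrywise arithmetic of 2 by 2 matrices\<close>

definition mat2 :: "complex \<Rightarrow> complex \<Rightarrow> complex \<Rightarrow> complex \<Rightarrow> complex mat" where
  "mat2 a b c d = mat 2 2 (\<lambda>(i, j). if i = 0 then if j = 0 then a else b else if j = 0 then c else d)"

lemma less_2_iff: "i < 2 \<longleftrightarrow> i = 0 \<or> i = (1 :: nat)"
  by auto

lemma mat2_carrier [simp]: "mat2 a b c d \<in> carrier_mat 2 2"
  by (simp add: mat2_def)

lemma mat2_dim [simp]: "dim_row (mat2 a b c d) = 2" "dim_col (mat2 a b c d) = 2"
  by (simp_all add: mat2_def)

lemma mat2_index [simp]:
  "mat2 a b c d $$ (0, 0) = a" "mat2 a b c d $$ (0, Suc 0) = b"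
  "mat2 a b c d $$ (Suc 0, 0) = c" "mat2 a b c d $$ (Suc 0, Suc 0) = d"
  by (simp_all add: mat2_def)

lemma mat2_inject [simp]:
  "mat2 a b c d = mat2 a' b' c' d' \<longleftrightarrow> a = a' \<and> b = b' \<and> c = c' \<and> d = d'"
  using mat2_index[of a b c d] mat2_index[of a' b' c' d'] by metis

lemma mat2_eta:
  assumes "A \<in> carrier_mat 2 2"
  shows "A = mat2 (A $$ (0, 0)) (A $$ (0, 1)) (A $$ (1, 0)) (A $$ (1, 1))"
  using assms by (intro eq_matI) (auto simp: less_2_iff)

lemma mat2_mult:
  "mat2 a b c d * mat2 a' b' c' d' =
    mat2 (a * a' + b * c') (a * b' + b * d') (c * a' + d * c') (c * b' + d * d')"
proof -
  have "{0..<2} = {0, 1 :: nat}" by auto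
  then have sum2: "sum f {0..<2} = f 0 + f 1" for f :: "nat \<Rightarrow> complex" by simp
  show ?thesis by (rule eq_matI) (auto simp: less_2_iff scalar_prod_def sum2)
qed

lemma mat2_minus: "mat2 a b c d - mat2 a' b' c' d' = mat2 (a - a') (b - b') (c - c') (d - d')"
  by (intro eq_matI) (auto simp: less_2_iff)

lemma mat2_one: "1\<^sub>m 2 = mat2 1 0 0 1"
  by (intro eq_matI) (auto simp: less_2_iff)

lemma mat2_zero: "0\<^sub>m 2 2 = mat2 0 0 0 0"
  by (intro eq_matI) (auto simp: less_2_iff)

lemma mat2_adjoint: "mat_adjoint (mat2 a b c d) = mat2 (cnj a) (cnj c) (cnj b) (cnj d)"
  by (intro eq_matI) (auto simp: less_2_iff)

lemma sa_mats_mat2: "mat2 a b c d \<in> sa_mats 2 \<longleftrightarrow> a \<in> \<real> \<and> d \<in> \<real> \<and> c = cnj b"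
  by (auto simp: sa_mats_def mat2_adjoint Reals_cnj_iff)

section \<open>Uniqueness of the witness for one explicit pair\<close>

text \<open>Testing on real vectors and taking real parts turns positivity into real polynomial
  inequalities, which is all that \<open>entries_unique\<close> uses.\<close>

lemma psd_mat2D:
  fixes x y :: real
  assumes "psd 2 (mat2 a b c d)"
  shows "0 \<le> Re a * x\<^sup>2 + (Re b + Re c) * x * y + Re d * y\<^sup>2"
proof -
  define v where "v = vec 2 (\<lambda>i. complex_of_real (if i = 0 then x else y))"
  have "(mat2 a b c d *\<^sub>v v) \<bullet>c v = (a * x + b * y) * x + (c * x + d * y) * y"
    by (simp add: v_def scalar_prod_def mat2_def numeral_2_eq_2)
  moreover have "0 \<le> (mat2 a b c d *\<^sub>v v) \<bullet>c v"
    using assms by (simp add: psd_def v_def)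
  ultimately have "0 \<le> Re ((a * x + b * y) * x + (c * x + d * y) * y)"
    by (simp add: less_eq_complex_def)
  then show ?thesis by (simp add: algebra_simps power2_eq_square)
qed

text \<open>Let \<open>W\<^sub>0\<close> have diagonal entries 4/5 and off-diagonal entries 1/5, and put \<open>D = W\<^sub>0 - W\<close>. The
  weights 1/128 and 125/384 and the vectors (37, -13) and (1, -1) come from writing the solution
  \<open>M\<close> of \<open>W\<^sub>0M + MW\<^sub>0 = ww\<^sup>*\<close>, \<open>w = (4, -1)\<close>, as a positive combination of two rank one matrices.
  Since \<open>w\<close> spans the kernel of \<open>W\<^sub>0 - Y\<^sup>2\<close>, this gives \<open>0 \<ge> w\<^sup>*Dw = tr ((W\<^sub>0\<^sup>2 - W\<^sup>2 + D\<^sup>2)M) \<ge> tr (D\<^sup>2M)\<close>,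
  so \<open>D = 0\<close>.\<close>

lemma entries_unique:
  fixes p r u v :: real
  assumes w: "(p - 3/4) * 4\<^sup>2 + (u + u) * 4 * (-1) + r * (-1)\<^sup>2 \<ge> 0"
    and Q: "\<And>x y. 0 \<le> (17/25 - p\<^sup>2 - u\<^sup>2 - v\<^sup>2) * x\<^sup>2 + 2 * (8/25 - u * (p + r)) * x * y
        + (17/25 - r\<^sup>2 - u\<^sup>2 - v\<^sup>2) * y\<^sup>2"
  shows "p = 4/5 \<and> r = 4/5 \<and> u = 1/5 \<and> v = 0"
proof -
  define P S q where "P = 4/5 - p" and "S = 4/5 - r" and "q = 1/5 - u"
  have nonpos: "- A - 1/128 * B - 125/384 * C \<le> 0" if "0 \<le> A" "0 \<le> B" "0 \<le> C" for A B C :: real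
    using that by linarith
  \<comment> \<open>The left side is tr(D^2 M): each bracket is the squared norm of D at one of the
    two vectors, with 1538 = 37^2 + 13^2 collecting the imaginary off-diagonal part. On the right,
    17/25 and 8/25 are the entries of I - X^2, which equals the square of \<open>W\<^sub>0\<close>,
    and the first summand is minus the form of W - Y^2 at (4, -1).\<close>
  have "1/128 * ((37 * P - 13 * q)\<^sup>2 + (37 * q - 13 * S)\<^sup>2 + 1538 * v\<^sup>2)
      + 125/384 * ((P - q)\<^sup>2 + (q - S)\<^sup>2 + 2 * v\<^sup>2) =
    - ((p - 3/4) * 4\<^sup>2 + (u + u) * 4 * (-1) + r * (-1)\<^sup>2)
    - 1/128 * ((17/25 - p\<^sup>2 - u\<^sup>2 - v\<^sup>2) * 37\<^sup>2 + 2 * (8/25 - u * (p + r)) * 37 * (-13)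
        + (17/25 - r\<^sup>2 - u\<^sup>2 - v\<^sup>2) * (-13)\<^sup>2)
    - 125/384 * ((17/25 - p\<^sup>2 - u\<^sup>2 - v\<^sup>2) * 1\<^sup>2 + 2 * (8/25 - u * (p + r)) * 1 * (-1)
        + (17/25 - r\<^sup>2 - u\<^sup>2 - v\<^sup>2) * (-1)\<^sup>2)"
    unfolding P_def S_def q_def by (simp add: power2_eq_square field_simps)
  also have "\<dots> \<le> 0" by (rule nonpos[OF w Q Q])
  finally have *: "1/128 * ((37 * P - 13 * q)\<^sup>2 + (37 * q - 13 * S)\<^sup>2 + 1538 * v\<^sup>2)
      + 125/384 * ((P - q)\<^sup>2 + (q - S)\<^sup>2 + 2 * v\<^sup>2) \<le> 0" .
  have zero: "A = 0 \<and> C = 0 \<and> D = 0 \<and> E = 0"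
    if "1/128 * (A + B + 1538 * C) + 125/384 * (D + E + 2 * C) \<le> 0"
      "0 \<le> A" "0 \<le> B" "0 \<le> C" "0 \<le> D" "0 \<le> E" for A B C D E :: real
    using that by argo
  \<comment> \<open>The two vectors are linearly independent: \<open>37 * P = 13 * q\<close> and
    \<open>P = q\<close> force \<open>q = 0\<close>, and then \<open>P\<close> and \<open>S\<close>
    vanish.\<close>
  have "37 * P = 13 * q" "v = 0" "P = q" "q = S"
    using zero[OF *] by auto
  then show ?thesis by (simp add: P_def S_def q_def)
qed

text \<open>Self-adjointness leaves four real unknowns, and the two positivity conditions become the
  hypotheses of \<open>entries_unique\<close>. Only the square of \<open>s\<close> enters, so the
  square root stays out of the arithmetic.\<close>

lemma C_set_witness_unique:
  fixes s :: complex
  assumes s: "s * s = 3/4" and W: "W \<in> sa_mats 2"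
    and Q: "psd 2 (1\<^sub>m 2 - mat2 (2/5) (-2/5) (-2/5) (2/5) ^\<^sub>m 2 - W ^\<^sub>m 2)"
    and w: "psd 2 (W - mat2 s 0 0 0 ^\<^sub>m 2)"
  shows "W = mat2 (4/5) (1/5) (1/5) (4/5)"
proof -
  obtain a b c d where W2: "W = mat2 a b c d" using mat2_eta[OF sa_matsD(1)[OF W]] by blast
  define p r u v where "p = Re a" and "r = Re d" and "u = Re b" and "v = Im b"
  have abcd: "a = of_real p" "d = of_real r" "b = Complex u v" "c = Complex u (- v)"
    using W by (auto simp: W2 sa_mats_mat2 p_def r_def u_def v_def complex_eq_iff elim!: Reals_cases)
  have "0 \<le> (17/25 - p\<^sup>2 - u\<^sup>2 - v\<^sup>2) * x\<^sup>2 + 2 * (8/25 - u * (p + r)) * x * y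
        + (17/25 - r\<^sup>2 - u\<^sup>2 - v\<^sup>2) * y\<^sup>2" for x y :: real
    using psd_mat2D[OF Q[unfolded W2 pow_mat_2[OF mat2_carrier] mat2_mult mat2_one mat2_minus], of x y]
    by (simp add: abcd algebra_simps power2_eq_square)
  moreover have "(p - 3/4) * 4\<^sup>2 + (u + u) * 4 * (-1) + r * (-1)\<^sup>2 \<ge> 0"
    using psd_mat2D[OF w[unfolded W2 pow_mat_2[OF mat2_carrier] mat2_mult mat2_one mat2_minus], of 4 "-1"]
    by (simp add: abcd s)
  ultimately have "p = 4/5 \<and> r = 4/5 \<and> u = 1/5 \<and> v = 0" by (intro entries_unique) auto
  then show ?thesis by (simp add: W2 abcd complex_eq_iff)
qed

theorem proposition7p8:
  shows "(\<forall>n. co_mat 2 D_p n \<subseteq> C_set n) \<and> (\<exists>n. co_mat 2 D_p n \<noteq> C_set n)"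
proof
  show "\<forall>n. co_mat 2 D_p n \<subseteq> C_set n"
    using co_mat_D_p_subset compressions_subset_C_set by blast
  define s :: complex where "s = of_real (sqrt 3 / 2)"
  \<comment> \<open>\<open>X\<close> and \<open>W\<close> share the eigenvectors (1, 1) and (1, -1),
    with eigenvalues 0, 4/5 and 1, 3/5, so their squares add up to the identity. The value 3/4 of
    \<open>s * s\<close> makes the determinant of \<open>W - Y ^\<^sub>m 2\<close> zero.\<close>
  define X Y W where "X = mat2 (2/5) (-2/5) (-2/5) (2/5)" and "Y = mat2 s 0 0 0"
    and "W = mat2 (4/5) (1/5) (1/5) (4/5)"
  note defs = X_def Y_def W_def
  note mat2_simps = pow_mat_2[OF mat2_carrier] mat2_mult mat2_one mat2_minus mat2_zero mat2_adjoint
  have s: "s * s = 3/4" unfolding s_def of_real_mult[symmetric] by simp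
  have sa: "X \<in> sa_mats 2" "Y \<in> sa_mats 2" "W \<in> sa_mats 2"
    by (auto simp: defs s_def sa_mats_mat2)
  have XW: "1\<^sub>m 2 - X ^\<^sub>m 2 - W ^\<^sub>m 2 = 0\<^sub>m 2 2"
    by (simp add: defs mat2_simps)
  have "psd 2 (0\<^sub>m 2 2)"
    using psd_gram[of "0\<^sub>m 2 2" 2 2] by (simp add: mat2_simps)
  moreover have "psd 2 (W - Y ^\<^sub>m 2)"
    \<comment> \<open>\<open>W - Y ^\<^sub>m 2\<close> is 1/20 times the rank one matrix of (1, 4).
      Writing 1/20 as (1/10)^2 + (2/10)^2 gives a Gram factor with rational entries, whose rows are
      multiples of (1, 4).\<close>
    using psd_gram[OF mat2_carrier, of "1/10" "4/10" "2/10" "8/10"] by (simp add: defs mat2_simps s)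
  ultimately have "\<exists>W \<in> sa_mats 2. psd 2 (1\<^sub>m 2 - X ^\<^sub>m 2 - W ^\<^sub>m 2) \<and> psd 2 (W - Y ^\<^sub>m 2)"
    using sa(3) XW by metis
  then have C: "[X, Y] \<in> C_set 2"
    using sa by (simp add: C_set_def sa_tuples_def)
  have "[X, Y] \<notin> D_p_compressions 2"
  proof
    assume "[X, Y] \<in> D_p_compressions 2"
    then obtain N V X' Y' where
      XY: "[X, Y] = [mat_adjoint V * X' * V, mat_adjoint V * Y' * V]"
      and D: "[X', Y'] \<in> D_p N" and V: "V \<in> isometries 2 N"
      unfolding D_p_compressions_def by blast
    from XY have X: "X = mat_adjoint V * X' * V" and Y: "Y = mat_adjoint V * Y' * V"
      by simp_all
    note Y' = D_pD(3)[OF D]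
    \<comment> \<open>The compression of the square of \<open>Y'\<close> is itself a witness for
      \<open>(X, Y)\<close>, by the inequalities that placed compressions in
      \<open>C_set\<close>.\<close>
    have "mat_adjoint V * Y' ^\<^sub>m 2 * V = W"
      unfolding W_def
    proof (rule C_set_witness_unique[OF s])
      show "mat_adjoint V * Y' ^\<^sub>m 2 * V \<in> sa_mats 2"
        by (rule sa_mats_compress[OF sa_mats_pow[OF Y'] isometriesD(1)[OF V]])
      show "psd 2 (1\<^sub>m 2 - mat2 (2/5) (-2/5) (-2/5) (2/5) ^\<^sub>m 2 - (mat_adjoint V * Y' ^\<^sub>m 2 * V) ^\<^sub>m 2)"
        using compression_psd[OF D V, folded X] by (simp add: X_def)
      show "psd 2 (mat_adjoint V * Y' ^\<^sub>m 2 * V - mat2 s 0 0 0 ^\<^sub>m 2)"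
        using compression_square_ge[OF Y' V, folded Y] by (simp add: Y_def)
    qed
    then have "Y * W = W * Y"
      using compression_commute[OF D V, folded X Y] XW by simp
    \<comment> \<open>Comparing upper right entries would give \<open>s / 5 = 0\<close>.\<close>
    then show False using s by (simp add: defs mat2_mult)
  qed
  then show "\<exists>n. co_mat 2 D_p n \<noteq> C_set n"
    using C co_mat_D_p_subset by blast
qed

end
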